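(* Let $m, k$ be positive integers with $\gcd(k,m)=1$, let $r\in\{1,\ldots,m-1\}$ be such that $kr\equiv 1 \pmod m$, and let $\alpha,\gamma\in\{0,1\}$. Put $q=2^m$ and $\sigma=2^k$. Then the mapping $H_{\alpha,\gamma}: x\mapsto H_{\alpha,\gamma}(x)$, $x\in\mathbf{F}_q$, maps $\mathbf{T}_0$ bijectively to $\mathbf{T}_0$, and maps $\mathbf{T}_1$ bijectively to $\mathbf{T}_{r+(\alpha+\gamma)m}$. In particular, the polynomial $H_{\alpha,\gamma}(X)$ is a permutation polynomial of $\mathbf{F}_{2^m}$ if and only if $r+(\alpha+\gamma)m\equiv 1 \pmod 2$.
   Context: $\mathbf{F}_q$ denotes the finite field with $q=2^m$ elements. A polynomial over $\mathbf{F}_q$ is a permutation polynomial of $\mathbf{F}_q$ if its associated function $\mathbf{F}_q\to\mathbf{F}_q$ is a bijection. $\mathrm{Tr}(X)=X+X^2+\cdots+X^{2^{m-1}}\in\mathbf{F}_2[X]$; on $\mathbf{F}_q$ it induces the trace from $\mathbf{F}_q$ to $\mathbf{F}_2$. For $e\in\mathbf{F}_2$, $\mathbf{T}_e=\{x\in\mathbf{F}_q\mid \mathrm{Tr}(x)=e\}$; an integer subscript is read modulo 2. For $\alpha,\gamma\in\{0,1\}$, $$H_{\alpha,\gamma}(X)=\gamma\,\mathrm{Tr}(X)+\frac{\left(\alpha\,\mathrm{Tr}(X)+\sum_{i=0}^{r-1}X^{\sigma^i}\right)^{\sigma+1}}{X^2},$$ which is a polynomial in $X$ with coefficients in $\mathbf{F}_2$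 (the division is performed in $\mathbf{F}_2[X]$), and $H_{\alpha,\gamma}(0)=0$. *)

theory Defs
  imports
    "HOL-Library.Cardinality"
    "HOL-Library.Z2"
    "HOL-Computational_Algebra.Polynomial"
    "HOL-Number_Theory.Cong"
begin

text \<open>
  The type \<^typ>\<open>bit\<close> is the field with two elements. The field with \<open>2 ^ m\<close> elements is a type
  \<open>'a :: {field, finite}\<close> with \<open>CARD('a) = 2 ^ m\<close>; \<open>of_bit\<close> embeds the prime field into it.
\<close>

abbreviation base_change :: "bit poly \<Rightarrow> 'a::field poly" where
  "base_change \<equiv> map_poly of_bit"

definition permutation_polynomial :: "'a::{field, finite} poly \<Rightarrow> bool" where
  "permutation_polynomial f \<longleftrightarrow> bij (poly f)"

definition trace_poly :: "nat \<Rightarrow> bit poly" where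
  "trace_poly m = (\<Sum>i<m. monom 1 (2 ^ i))"

definition trace_set :: "nat \<Rightarrow> bit \<Rightarrow> 'a::field set" where
  "trace_set m e = {x. poly (base_change (trace_poly m)) x = of_bit e}"

definition H_numerator :: "nat \<Rightarrow> nat \<Rightarrow> nat \<Rightarrow> nat \<Rightarrow> bit poly" where
  "H_numerator m \<sigma> r \<alpha> =
     (smult (of_nat \<alpha>) (trace_poly m) + (\<Sum>i<r. monom 1 (\<sigma> ^ i))) ^ (\<sigma> + 1)"

text \<open>
  Here \<open>div\<close> is Euclidean division in \<open>bit poly\<close>; it is exact for \<open>\<sigma> > 0\<close> by
  \<open>X_squared_dvd_H_numerator\<close> below.
\<close>

definition H_poly :: "nat \<Rightarrow> nat \<Rightarrow> nat \<Rightarrow> nat \<Rightarrow> nat \<Rightarrow> bit poly" where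
  "H_poly m \<sigma> r \<alpha> \<gamma> =
     smult (of_nat \<gamma>) (trace_poly m) + H_numerator m \<sigma> r \<alpha> div monom 1 2"

lemma coeff_0_trace_poly: "coeff (trace_poly m) 0 = 0"
  by (simp add: trace_poly_def coeff_sum)

lemma X_power_dvd_H_numerator:
  assumes "\<sigma> > 0"
  shows "monom 1 (\<sigma> + 1) dvd H_numerator m \<sigma> r \<alpha>"
proof -
  define P where "P = smult (of_nat \<alpha>) (trace_poly m) + (\<Sum>i<r. monom (1::bit) (\<sigma> ^ i))"
  have "coeff P 0 = 0"
    using assms by (simp add: P_def coeff_sum coeff_0_trace_poly del: power_bit_unfold)
  then have "monom 1 1 dvd P"
    by (simp add: monom_1_dvd_iff' del: One_nat_def)
  then have "monom 1 1 ^ (\<sigma> + 1) dvd P ^ (\<sigma> + 1)"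
    by (rule dvd_power_same)
  moreover have "monom (1::bit) 1 ^ (\<sigma> + 1) = monom 1 (\<sigma> + 1)"
    by (simp only: monom_power power_one mult_1)
  ultimately show ?thesis
    by (simp only: H_numerator_def P_def)
qed

lemma X_squared_dvd_H_numerator:
  assumes "\<sigma> > 0"
  shows "monom 1 2 dvd H_numerator m \<sigma> r \<alpha>"
proof -
  have "monom (1::bit) 2 dvd monom 1 (\<sigma> + 1)"
    using assms by (simp add: monom_1_dvd_iff')
  then show ?thesis
    using X_power_dvd_H_numerator[OF assms] dvd_trans by blast
qed

lemma coeff_0_H_poly:
  assumes "\<sigma> > 1"
  shows "coeff (H_poly m \<sigma> r \<alpha> \<gamma>) 0 = 0"
proof -
  from assms have "\<sigma> > 0" by simp
  from X_power_dvd_H_numerator[OF this, of m r \<alpha>]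
  obtain Q where Q: "H_numerator m \<sigma> r \<alpha> = monom 1 (\<sigma> + 1) * Q"
    by (elim dvdE)
  have "monom (1::bit) (\<sigma> + 1) = monom 1 2 * monom 1 (\<sigma> - 1)"
    using assms by (simp add: mult_monom)
  with Q have "H_numerator m \<sigma> r \<alpha> div monom 1 2 = monom 1 (\<sigma> - 1) * Q"
    by (simp add: mult.assoc)
  with assms show ?thesis
    by (simp add: H_poly_def coeff_0_trace_poly coeff_mult)
qed

end

theory Submission
  imports Defs
begin

text \<open>
  Write \<open>\<sigma> = 2 ^ k\<close>, \<open>Q(x) = (\<Sum>i<r. x ^ \<sigma> ^ i)\<close>, \<open>S(x) = (\<Sum>i<k. x ^ 2 ^ i)\<close> and
  \<open>P(x) = Q(x) + \<alpha> Tr(x)\<close>. Since \<open>k r \<equiv> 1\<close> modulo \<open>m\<close>, the sum telescopes to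
  \<open>P(x) ^ \<sigma> + P(x) = x^2 + x\<close>, so \<open>a = P(x) ^ (\<sigma> + 1) / x^2\<close> equals \<open>(P(x)/x)^2 + P(x)/x + P(x)\<close>
  and has the same trace as \<open>P(x)\<close>.

  For injectivity on a trace class, put \<open>z = P(x)/x\<close>. Then \<open>x = z + 1 + a/z\<close>, and \<open>z\<close> is a root of
  \<open>Z ^ (\<sigma> + 1) + c Z + a\<close> with \<open>c + S(a)\<close> in the prime field. Taking the trace of \<open>x\<close>
  and applying \<open>Q\<close> to it determines \<open>m (c + S(a))\<close> and \<open>r (c + S(a))\<close> from \<open>a\<close> and \<open>Tr(x)\<close>;
  as \<open>m\<close> and \<open>r\<close> are not both even, \<open>c\<close> depends only on \<open>a\<close> and \<open>Tr(x)\<close>.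
  Every further root \<open>z'\<close> gives a solution \<open>y = z x / (z' + z)\<close> of \<open>y ^ \<sigma> + y = x\<close>. If
  \<open>Tr(x) = 1\<close> there is none. If \<open>Tr(x) = 0\<close> there are at most two, but both solutions of
  \<open>w^2 + w = a\<close> are roots that do not arise from a nonzero \<open>x\<close>, so only \<open>z\<close> remains.
\<close>

section \<open>Fields with $2^m$ elements\<close>

text \<open>Covers the trace (\<open>frob_sum 2 m\<close>), \<open>S\<close>
  (\<open>frob_sum 2 k\<close>) and \<open>Q\<close> (\<open>frob_sum (2 ^ k) r\<close>) at
  once.\<close>

definition frob_sum :: "nat \<Rightarrow> nat \<Rightarrow> 'a::comm_semiring_1 \<Rightarrow> 'a" where
  "frob_sum s n x = (\<Sum>i<n. x ^ (s ^ i))"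

text \<open>Multiplication by a nonzero \<open>x\<close> permutes the nonzero elements; comparing
  their product before and after gives \<open>x ^ card ?U = 1\<close>.\<close>

lemma finite_field_power_card:
  fixes x :: "'a::{field, finite}"
  shows "x ^ CARD('a) = x"
proof (cases "x = 0")
  case False
  let ?U = "UNIV - {0::'a}"
  have "bij_betw (\<lambda>y. x * y) ?U ?U"
    by (rule bij_betw_byWitness[of _ "\<lambda>y. y / x"]) (use False in auto)
  then have "(\<Prod>y\<in>?U. x * y) = \<Prod>?U"
    by (rule prod.reindex_bij_betw[of _ _ _ "\<lambda>y. y"])
  then have "x ^ card ?U * \<Prod>?U = \<Prod>?U"
    by (simp add: prod.distrib)
  then have "x ^ card ?U = 1"
    by simp
  moreover have "CARD('a) = Suc (card ?U)"
    by (subst card_Suc_Diff1) auto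
  ultimately show ?thesis
    by (simp only: power_Suc mult_1_right)
qed (simp add: zero_power)

locale binary_field =
  fixes m :: nat and ty :: "'a::{field, finite} itself"
  assumes card: "CARD('a) = 2 ^ m"
begin

abbreviation tr :: "'a \<Rightarrow> 'a" where "tr \<equiv> frob_sum 2 m"

text \<open>Translation by 1 permutes the field, so summing all elements yields
  \<open>of_nat (2 ^ m) = 0\<close>, and the characteristic is a prime dividing a power of
  2.\<close>

lemma CHAR_eq_2: "CHAR('a) = 2"
proof -
  have p: "prime CHAR('a)"
    by (intro prime_CHAR_semidom finite_imp_CHAR_pos) auto
  have "bij_betw (\<lambda>x. x + 1) (UNIV :: 'a set) UNIV"
    by (rule bij_betw_byWitness[of _ "\<lambda>x. x - 1"]) auto
  then have "(\<Sum>x\<in>UNIV. x + 1) = (\<Sum>x\<in>UNIV. x::'a)"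
    by (rule sum.reindex_bij_betw[of _ _ _ "\<lambda>x. x"])
  then have "of_nat (2 ^ m) = (0::'a)"
    by (simp add: sum.distrib card del: of_nat_power)
  then have "CHAR('a) dvd 2 ^ m"
    by (simp only: of_nat_eq_0_iff_char_dvd)
  then have "CHAR('a) dvd 2"
    using p prime_dvd_power by blast
  with p show ?thesis
    using primes_dvd_imp_eq two_is_prime_nat by blast
qed

lemma m_pos: "m > 0"
proof (rule ccontr)
  assume "\<not> m > 0"
  then have "CARD('a) = 1"
    by (simp add: card)
  then obtain c :: 'a where "UNIV = {c}"
    by (auto simp: card_1_singleton_iff)
  then have "(0::'a) = 1"
    by (metis UNIV_I singletonD)
  then show False
    by simp
qed

lemma two_eq_0: "(2::'a) = 0"
  using of_nat_CHAR[where 'a = 'a] by (simp add: CHAR_eq_2)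

lemma add_self: "x + x = (0::'a)"
  by (metis mult_2 mult_zero_left two_eq_0)

lemma add_self_left: "x + (x + y) = (y::'a)"
  by (simp add: add_self flip: add.assoc)

lemma diff_eq_add: "x - y = x + (y::'a)"
  by (simp add: minus_CHAR_2 CHAR_eq_2)

lemma minus_eq: "- x = (x::'a)"
  by (simp add: uminus_CHAR_2 CHAR_eq_2)

lemmas char2_simps = add_self add_self_left diff_eq_add minus_eq

lemma add_eq_0_iff_eq: "x + y = 0 \<longleftrightarrow> x = (y::'a)"
  by (metis diff_eq_add right_minus_eq)

lemma add_eq_iff: "x + y = z \<longleftrightarrow> x = z + (y::'a)"
  by (metis add_diff_cancel_right' diff_add_cancel diff_eq_add)

lemma of_nat_parity: "of_nat n = (of_bool (odd n) :: 'a)"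
  by (induction n) (auto simp: add_self)

lemma add_power_two_power: "(x + y :: 'a) ^ (2 ^ n) = x ^ (2 ^ n) + y ^ (2 ^ n)"
  by (rule freshmans_dream') (simp_all add: CHAR_eq_2)

lemma sum_power_two_power: "(\<Sum>i\<in>A. f i :: 'a) ^ (2 ^ n) = (\<Sum>i\<in>A. f i ^ (2 ^ n))"
  by (rule freshmans_dream_sum') (simp_all add: CHAR_eq_2)

lemma add_square: "(x + y :: 'a)\<^sup>2 = x\<^sup>2 + y\<^sup>2"
  using add_power_two_power[of x y 1] by simp

lemma power_card: "(x::'a) ^ (2 ^ m) = x"
  using finite_field_power_card[of x] by (simp add: card)

lemma power_two_power_mult: "(x::'a) ^ (2 ^ (m * j)) = x"
proof (induction j)
  case (Suc j)
  have "x ^ (2 ^ (m * Suc j)) = (x ^ (2 ^ m)) ^ (2 ^ (m * j))"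
    by (simp add: power_add power_mult)
  then show ?case
    by (simp add: power_card Suc)
qed simp

lemma square_eq_self_iff: "(x::'a)\<^sup>2 = x \<longleftrightarrow> x \<in> {0, 1}"
  by (auto simp: power2_eq_square)

section \<open>Sums of Frobenius iterates and the trace\<close>

lemma frob_sum_add:
  "frob_sum (2 ^ k) n (x + y :: 'a) = frob_sum (2 ^ k) n x + frob_sum (2 ^ k) n y"
  by (simp add: frob_sum_def add_power_two_power sum.distrib flip: power_mult)

lemmas tr_add = frob_sum_add[of 1 m, simplified]

lemma frob_sum_0: "frob_sum (2 ^ k) n (0::'a) = 0"
  by (simp add: frob_sum_def zero_power)

lemma frob_sum_1: "frob_sum s n (1::'a) = of_nat n"
  by (simp add: frob_sum_def)

lemma frob_sum_bit:
  assumes "x \<in> {0, 1::'a}"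
  shows "frob_sum (2 ^ k) n x = of_nat n * x"
  using assms by (auto simp: frob_sum_0 frob_sum_1)

lemma frob_sum_power:
  "frob_sum (2 ^ k) n ((x::'a) ^ (2 ^ l)) = frob_sum (2 ^ k) n x ^ (2 ^ l)"
  by (simp add: frob_sum_def sum_power_two_power mult.commute flip: power_mult)

text \<open>Raising to the power \<open>2 ^ k\<close> shifts the summation index by one, so only the
  two end terms survive.\<close>

lemma frob_sum_telescope:
  "frob_sum (2 ^ k) n (x::'a) ^ (2 ^ k) + frob_sum (2 ^ k) n x = x ^ (2 ^ (k * n)) + x"
proof -
  have "frob_sum (2 ^ k) n x ^ (2 ^ k) = (\<Sum>i<n. x ^ ((2 ^ k) ^ Suc i))"
    by (simp add: frob_sum_def sum_power_two_power mult.commute flip: power_mult)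
  then have "frob_sum (2 ^ k) n x ^ (2 ^ k) - frob_sum (2 ^ k) n x = x ^ ((2 ^ k) ^ n) - x ^ ((2 ^ k) ^ 0)"
    using sum_lessThan_telescope[of "\<lambda>i. x ^ ((2 ^ k) ^ i)" n]
    by (simp only: frob_sum_def sum_subtractf)
  then show ?thesis
    by (simp add: diff_eq_add power_mult)
qed

lemma frob_sum_split:
  "frob_sum s (a + b) x = frob_sum s a x + frob_sum s b (x ^ (s ^ a))"
proof -
  have "frob_sum s (a + b) x = frob_sum s a x + (\<Sum>i<b. x ^ (s ^ (a + i)))"
    unfolding frob_sum_def by (induction b) (simp_all add: add.assoc)
  then show ?thesis
    by (simp add: frob_sum_def power_add power_mult)
qed

text \<open>The exponents \<open>2 ^ (k * i + l)\<close> with \<open>i < n\<close> and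
  \<open>l < k\<close> meet each \<open>2 ^ t\<close> with \<open>t < k * n\<close> exactly
  once.\<close>

lemma frob_sum_frob_sum:
  "frob_sum (2 ^ k) n (frob_sum 2 k (x::'a)) = frob_sum 2 (k * n) x"
proof (induction n)
  case (Suc n)
  have "frob_sum 2 k x ^ (2 ^ (k * n)) = frob_sum 2 k (x ^ (2 ^ (k * n)))"
    using frob_sum_power[of 1 k x "k * n"] by simp
  then show ?case
    using Suc frob_sum_split[of 2 "k * n" k x]
    by (simp add: frob_sum_def add.commute flip: power_mult)
qed (simp add: frob_sum_def)

lemma tr_square: "(tr x)\<^sup>2 = tr x"
  using frob_sum_telescope[of 1 m x]
  by (simp add: power_card add_self add_eq_0_iff_eq)

lemma tr_bit: "tr x \<in> {0, 1}"
  using tr_square by (simp only: square_eq_self_iff)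

lemma tr_power: "tr (x ^ (2 ^ n)) = tr x"
proof -
  have "tr x ^ (2 ^ n) = tr x"
    using tr_bit[of x] by auto
  then show ?thesis
    using frob_sum_power[of 1 m x n] by simp
qed

lemma tr_square_arg: "tr (x\<^sup>2) = tr x"
  using tr_power[of x 1] by simp

lemma tr_bit_mult: "b \<in> {0, 1} \<Longrightarrow> tr b = of_nat m * b"
  using frob_sum_bit[of b 1 m] by simp

text \<open>Since \<open>x ^ (2 ^ m) = x\<close>, the terms repeat with period \<open>m\<close>:
  they form \<open>j\<close> full traces and one extra \<open>x\<close>.\<close>

lemma frob_sum_2_Suc_mult: "frob_sum 2 (m * j + 1) (x::'a) = x + of_nat j * tr x"
proof -
  have "frob_sum 2 (m * j) x = of_nat j * tr x"
  proof (induction j)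
    case (Suc j)
    have "frob_sum 2 (m * Suc j) x = tr x + frob_sum 2 (m * j) x"
      using frob_sum_split[of 2 m "m * j" x] by (simp add: power_card)
    then show ?case
      by (simp only: Suc of_nat_Suc distrib_right mult_1)
  qed (simp add: frob_sum_def)
  moreover have "frob_sum 2 1 x = x"
    by (simp add: frob_sum_def)
  ultimately show ?thesis
    by (simp only: frob_sum_split[of 2 "m * j" 1 x] power_two_power_mult add.commute[of x])
qed

lemma tr_sum: "tr (\<Sum>i\<in>A. f i) = (\<Sum>i\<in>A. tr (f i))"
proof -
  have "tr 0 = 0"
    using frob_sum_0[of 1 m] by simp
  then show ?thesis
    by (induction A rule: infinite_finite_induct) (auto simp: tr_add)
qed

lemma tr_frob_sum: "tr (frob_sum (2 ^ k) n x) = of_nat n * tr x"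
  by (simp add: frob_sum_def[of "2 ^ k"] tr_sum tr_power flip: power_mult)

section \<open>Sizes of the trace classes and the Artin-Schreier equation\<close>

lemma ex_tr_1: "\<exists>t. tr t = 1"
proof -
  define p :: "'a poly" where "p = (\<Sum>i<m. monom 1 (2 ^ i))"
  \<comment> \<open>The linear coefficient shows \<open>p \<noteq> 0\<close>; as its degree is below
    \<open>CARD('a)\<close>, \<open>p\<close> cannot vanish everywhere.\<close>
  have "coeff p 1 = (\<Sum>i<m. if i = 0 then 1 else 0)"
    unfolding p_def coeff_sum by (intro sum.cong) auto
  then have "p \<noteq> 0"
    using m_pos by auto
  have "degree p \<le> 2 ^ (m - 1)"
    unfolding p_def
  proof (rule degree_sum_le)
    fix i assume "i \<in> {..<m}"
    then have "(2::nat) ^ i \<le> 2 ^ (m - 1)"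
      by (intro power_increasing) auto
    then show "degree (monom (1::'a) (2 ^ i)) \<le> 2 ^ (m - 1)"
      using degree_monom_le order_trans by blast
  qed simp
  also have "(2::nat) ^ (m - 1) < 2 ^ m"
    using m_pos by simp
  finally have "card {x. poly p x = 0} < CARD('a)"
    using card_poly_roots_bound[OF \<open>p \<noteq> 0\<close>] by (simp add: card)
  then have "{x. poly p x = 0} \<noteq> UNIV"
    by auto
  then obtain t where "poly p t \<noteq> 0"
    by auto
  then have "tr t \<noteq> 0"
    by (simp add: p_def frob_sum_def poly_sum poly_monom)
  then show ?thesis
    using tr_bit by blast
qed

lemma card_tr_sets:
  "card {x. tr x = 1} = card {x. tr x = 0}" "2 * card {x. tr x = 0} = CARD('a)"
proof -
  obtain t where t: "tr t = 1"
    using ex_tr_1 by blast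
  have "bij_betw (\<lambda>x. x + t) {x. tr x = 0} {x. tr x = 1}"
    by (rule bij_betw_byWitness[of _ "\<lambda>x. x + t"])
      (auto simp: t tr_add add_self add.assoc)
  then show eq: "card {x. tr x = 1} = card {x. tr x = 0}"
    using bij_betw_same_card by fastforce
  have "CARD('a) = card ({x. tr x = 0} \<union> {x. tr x = 1})"
    using tr_bit by (intro arg_cong[of _ _ card]) auto
  also have "\<dots> = card {x. tr x = 0} + card {x. tr x = 1}"
    by (rule card_Un_disjoint) auto
  finally show "2 * card {x. tr x = 0} = CARD('a)"
    using eq by simp
qed

text \<open>The fibres of \<open>w\<^sup>2 + w\<close> have at most two elements, so its image fills
  at least half of the field, which is the size of the trace 0 class containing it.\<close>

lemma artin_schreier:
  assumes "tr a = 0"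
  shows "\<exists>w. w\<^sup>2 + w = (a::'a)"
proof -
  define f :: "'a \<Rightarrow> 'a" where "f w = w\<^sup>2 + w" for w
  have sub: "range f \<subseteq> {x. tr x = 0}"
    by (auto simp: f_def tr_add tr_square_arg add_self)
  have fibre: "card {x. f x = f w} \<le> 2" for w
  proof -
    have "x \<in> {w, w + 1}" if "f x = f w" for x
    proof -
      have "(x + w)\<^sup>2 = x + w"
        using that unfolding f_def add_square
        by (metis add_eq_0_iff_eq add.assoc add.left_commute)
      then show ?thesis
        by (auto simp: square_eq_self_iff add_eq_0_iff_eq) (metis add_self_left add.commute)
    qed
    then have "{x. f x = f w} \<subseteq> {w, w + 1}"
      by blast
    then have "card {x. f x = f w} \<le> card {w, w + 1}"
      by (intro card_mono) auto
    also have "\<dots> \<le> 2"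
      by (simp add: card_insert_if)
    finally show ?thesis .
  qed
  have "CARD('a) = card (\<Union>b\<in>range f. {x. f x = b})"
    by (intro arg_cong[of _ _ card]) auto
  also have "\<dots> \<le> (\<Sum>b\<in>range f. card {x. f x = b})"
    by (rule card_UN_le) simp
  also have "\<dots> \<le> (\<Sum>b\<in>range f. 2)"
    using fibre by (intro sum_mono) auto
  finally have "card {x. tr x = 0} \<le> card (range f)"
    using card_tr_sets(2) by simp
  then have "range f = {x. tr x = 0}"
    using sub by (intro card_seteq) auto
  then have "a \<in> range f"
    using assms by simp
  then show ?thesis
    by (auto simp: f_def)
qed

section \<open>Evaluation of polynomials over the prime field\<close>

definition eval_bit_poly :: "bit poly \<Rightarrow> 'a \<Rightarrow> 'a" where
  "eval_bit_poly p x = poly (base_change p) x"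

lemma eval_bit_poly_add: "eval_bit_poly (p + q) x = eval_bit_poly p x + eval_bit_poly q x"
proof -
  have "of_bit (b + c) = (of_bit b + of_bit c :: 'a)" for b c
    by (cases b; cases c) (simp_all add: add_self)
  then have "base_change (p + q) = (base_change p + base_change q :: 'a poly)"
    by (intro poly_eqI) (simp add: coeff_map_poly)
  then show ?thesis
    by (simp add: eval_bit_poly_def)
qed

lemma eval_bit_poly_0: "eval_bit_poly 0 x = 0"
  by (simp add: eval_bit_poly_def)

lemma eval_bit_poly_1: "eval_bit_poly 1 x = 1"
  by (simp add: eval_bit_poly_def)

lemma eval_bit_poly_pCons: "eval_bit_poly (pCons c p) x = of_bit c + x * eval_bit_poly p x"
  by (simp add: eval_bit_poly_def map_poly_pCons)

lemma eval_bit_poly_smult: "eval_bit_poly (smult c p) x = of_bit c * eval_bit_poly p x"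
  by (cases c) (simp_all add: eval_bit_poly_0)

lemma eval_bit_poly_monom: "eval_bit_poly (monom 1 n) x = x ^ n"
  by (simp add: eval_bit_poly_def map_poly_monom poly_monom)

lemma eval_bit_poly_mult: "eval_bit_poly (p * q) x = eval_bit_poly p x * eval_bit_poly q x"
  by (induction p)
    (simp_all add: eval_bit_poly_0 eval_bit_poly_pCons eval_bit_poly_add eval_bit_poly_smult
      distrib_right mult.assoc)

lemma eval_bit_poly_power: "eval_bit_poly (p ^ n) x = eval_bit_poly p x ^ n"
  by (induction n) (simp_all add: eval_bit_poly_1 eval_bit_poly_mult)

lemma eval_bit_poly_sum: "eval_bit_poly (\<Sum>i\<in>A. f i) x = (\<Sum>i\<in>A. eval_bit_poly (f i) x)"
  by (induction A rule: infinite_finite_induct) (auto simp: eval_bit_poly_0 eval_bit_poly_add)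

lemma eval_trace_poly: "eval_bit_poly (trace_poly m) x = tr x"
  by (simp add: trace_poly_def eval_bit_poly_sum eval_bit_poly_monom frob_sum_def)

lemma trace_set_eq: "trace_set m e = {x::'a. tr x = of_bit e}"
  by (simp only: trace_set_def eval_trace_poly flip: eval_bit_poly_def)

end

section \<open>Roots of the trinomials attached to the map\<close>

text \<open>The quotient \<open>j\<close> of the congruence is kept, since the parity of
  \<open>j\<close> enters the formula for \<open>Q (S x)\<close>.\<close>

locale frobenius_pair = binary_field m ty
  for m :: nat and ty :: "'a::{field, finite} itself" +
  fixes k r j :: nat
  assumes kr: "k * r = m * j + 1"
begin

abbreviation S :: "'a \<Rightarrow> 'a" where "S \<equiv> frob_sum 2 k"

abbreviation Q :: "'a \<Rightarrow> 'a" where "Q \<equiv> frob_sum (2 ^ k) r"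

text \<open>Ensures that one of the last two equations of \<open>root_equations\<close> determines
  \<open>c + S a\<close>.\<close>

lemma odd_m_or_r: "odd m \<or> odd r"
  using kr by (metis even_mult_iff even_add odd_one)

lemma k_pos: "k > 0"
  using kr by (cases k) auto

lemma power_two_power_kr: "(x::'a) ^ (2 ^ (k * r)) = x\<^sup>2"
proof -
  have "x ^ (2 ^ (k * r)) = (x ^ (2 ^ (m * j)))\<^sup>2"
    by (simp only: kr power_add power_one_right power_mult[of x])
  then show ?thesis
    by (simp only: power_two_power_mult)
qed

lemma Q_telescope: "Q x ^ (2 ^ k) + Q x = x\<^sup>2 + x"
  by (simp add: frob_sum_telescope power_two_power_kr)

lemma Q_bit_power:
  assumes "b \<in> {0, 1}"
  shows "(Q x + b) ^ (2 ^ k) = Q x + b + x\<^sup>2 + x"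
proof -
  have "b ^ (2 ^ k) = b"
    using assms by auto
  moreover have "Q x ^ (2 ^ k) = x\<^sup>2 + x + Q x"
    by (rule add_eq_iff[THEN iffD1, OF Q_telescope])
  ultimately show ?thesis
    by (simp only: add_power_two_power add_ac)
qed

lemma S_telescope: "(S x)\<^sup>2 + S x = x ^ (2 ^ k) + x"
  using frob_sum_telescope[of 1 k x] by simp

text \<open>The composite sums \<open>k * r = m * j + 1\<close> successive squarings of
  \<open>x\<close>.\<close>

lemma Q_S: "Q (S x) = x + of_nat j * tr x"
  using frob_sum_2_Suc_mult[of j x] by (simp add: frob_sum_frob_sum kr)

text \<open>A fixed point is also fixed by the \<open>r\<close>-th iterate, which is
  squaring.\<close>

lemma frobenius_fixed:
  assumes "(y::'a) ^ (2 ^ k) = y"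
  shows "y \<in> {0, 1}"
proof -
  have "y ^ (2 ^ (k * n)) = y" for n
  proof (induction n)
    case (Suc n)
    have "y ^ (2 ^ (k * Suc n)) = (y ^ (2 ^ k)) ^ (2 ^ (k * n))"
      by (simp only: mult_Suc_right power_add power_mult[of y])
    then show ?case
      by (simp only: assms Suc)
  qed simp
  then have "y\<^sup>2 = y"
    using power_two_power_kr[of y] by (simp only:)
  then show ?thesis
    by (simp add: square_eq_self_iff)
qed

text \<open>The choice of \<open>c\<close> makes \<open>z\<close> a root by construction. The
  substance is that \<open>c + S a\<close> is a bit, and that the trace and \<open>Q\<close> of
  \<open>x\<close> constrain it.\<close>

lemma root_equations:
  fixes x a b :: 'a
  defines "P \<equiv> Q x + b"
  assumes x: "x \<noteq> 0" and P: "P \<noteq> 0" and b: "b \<in> {0, 1}"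
    and a: "P ^ (2 ^ k + 1) = a * x\<^sup>2"
  defines "z \<equiv> P / x"
  defines "c \<equiv> z ^ (2 ^ k) + a / z"
  shows "z ^ (2 ^ k + 1) + c * z + a = 0" and "x = z + 1 + a / z"
    and "a * x = (z * x) ^ (2 ^ k) * z"
    and "c + S a \<in> {0, 1}"
    and "of_nat m * (c + S a) = of_nat m + tr x + of_nat k * tr a"
    and "of_nat r * (c + S a) = of_nat r + b + of_nat j * tr a"
proof -
  have z: "z \<noteq> 0" and zx: "z * x = P"
    using x P by (auto simp: z_def)
  have tele: "P ^ (2 ^ k) = P + x\<^sup>2 + x"
    unfolding P_def by (rule Q_bit_power[OF b])
  have "x\<^sup>2 * (z\<^sup>2 + z + P) = P * (P + x\<^sup>2 + x)"
    unfolding zx[symmetric] by (simp add: power2_eq_square algebra_simps)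
  also have "\<dots> = x\<^sup>2 * a"
    using a tele by (simp add: mult.commute)
  finally have a_eq: "a = z\<^sup>2 + z + P"
    using x by simp
  then have a_eq': "a = z\<^sup>2 + z + z * x"
    by (simp add: zx)
  then have az: "a / z = z + 1 + x"
    using z by (simp add: field_simps power2_eq_square)
  then show x_eq: "x = z + 1 + a / z"
    by (simp add: char2_simps)
  show "z ^ (2 ^ k + 1) + c * z + a = 0"
    using z by (simp add: c_def char2_simps algebra_simps)
  have "P * (P ^ (2 ^ k) * z) = P * (a * x)"
    using a x unfolding zx[symmetric] by (simp add: power2_eq_square mult_ac)
  then show ax: "a * x = (z * x) ^ (2 ^ k) * z"
    using P by (simp add: zx)
  define e where "e = c + S a"
  \<comment> \<open>Counterpart of \<open>a_eq\<close> with \<open>a / z\<close> in place of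
    \<open>z\<close>: by \<open>ax\<close>, the left side is \<open>(a / z) * x\<close>, and
    \<open>x = z + 1 + a / z\<close>.\<close>
  have Ps: "P ^ (2 ^ k) = (a / z)\<^sup>2 + a / z + a"
  proof -
    have "z\<^sup>2 * ((a / z)\<^sup>2 + a / z + a) = a * (a + z + z\<^sup>2)"
      using z by (simp add: field_simps power2_eq_square)
    also have "\<dots> = a * P"
      by (subst (2) a_eq) (simp add: char2_simps add_ac)
    also have "\<dots> = z\<^sup>2 * P ^ (2 ^ k)"
      using ax by (simp add: zx power2_eq_square mult_ac flip: zx)
    finally show ?thesis
      using z by simp
  qed
  have "a ^ (2 ^ k) = (z ^ (2 ^ k))\<^sup>2 + z ^ (2 ^ k) + P ^ (2 ^ k)"
    by (subst a_eq) (simp add: add_power_two_power mult.commute flip: power_mult)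
  \<comment> \<open>Thus \<open>c\<close> and \<open>S a\<close> solve the same Artin-Schreier
    equation and differ by a bit.\<close>
  then have "c\<^sup>2 + c = a ^ (2 ^ k) + a"
    unfolding c_def Ps by (simp add: add_square char2_simps add_ac)
  moreover have "e\<^sup>2 + e = (c\<^sup>2 + c) + ((S a)\<^sup>2 + S a)"
    by (simp only: e_def add_square add_ac)
  ultimately have "e\<^sup>2 + e = 0"
    by (simp only: S_telescope add_self)
  then have e: "e \<in> {0, 1}"
    by (simp only: add_eq_0_iff_eq square_eq_self_iff)
  then show "c + S a \<in> {0, 1}"
    by (simp add: e_def)
  define u where "u = 1 + e"
  have u: "u \<in> {0, 1}"
    using e by (auto simp: u_def add_self)
  have u_mult: "n * e = n + n * u" for n
    by (simp add: u_def distrib_left char2_simps)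
  \<comment> \<open>In this form the trace kills \<open>z ^ (2 ^ k) + z\<close>, while
    \<open>Q\<close> turns it into \<open>z\<^sup>2 + z\<close>.\<close>
  have x_eq2: "x = z ^ (2 ^ k) + z + u + S a"
    by (subst x_eq) (simp add: u_def e_def c_def char2_simps add_ac)
  have trS: "tr (S a) = of_nat k * tr a"
    using tr_frob_sum[of 1] by simp
  have "tr x = of_nat m * u + of_nat k * tr a"
    by (subst x_eq2) (simp only: tr_add tr_power tr_bit_mult[OF u] trS add_self add_0)
  then show "of_nat m * (c + S a) = of_nat m + tr x + of_nat k * tr a"
    by (simp add: u_mult char2_simps add_ac flip: e_def)
  have "Q x = (Q z ^ (2 ^ k) + Q z) + of_nat r * u + (a + of_nat j * tr a)"
    by (subst x_eq2) (simp only: frob_sum_add frob_sum_power frob_sum_bit[OF u] Q_S)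
  also have "\<dots> = (z\<^sup>2 + z + a) + (of_nat r * u + of_nat j * tr a)"
    unfolding Q_telescope by (simp only: add_ac)
  also have "z\<^sup>2 + z + a = Q x + b"
    by (simp add: a_eq char2_simps P_def)
  finally have "b + (of_nat r * u + of_nat j * tr a) = 0"
    by (simp add: add.assoc)
  then have "b = of_nat r * u + of_nat j * tr a"
    by (simp only: add_eq_0_iff_eq)
  then show "of_nat r * (c + S a) = of_nat r + b + of_nat j * tr a"
    by (simp add: u_mult char2_simps add_ac flip: e_def)
qed

text \<open>Adding the two root equations gives \<open>eq\<close> for the difference
  \<open>d\<close> of the roots. Multiplied by \<open>z * x\<close> and divided by
  \<open>z * d * d ^ s\<close>, it becomes the claim, because \<open>ax\<close> turns the first term
  into \<open>y ^ s\<close>.\<close>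

lemma second_root:
  fixes x a z z' c :: 'a
  assumes z: "z \<noteq> 0" and neq: "z' \<noteq> z"
    and root: "z ^ (2 ^ k + 1) + c * z + a = 0" and root': "z' ^ (2 ^ k + 1) + c * z' + a = 0"
    and ax: "a * x = (z * x) ^ (2 ^ k) * z"
  defines "y \<equiv> z * x / (z' + z)"
  shows "y ^ (2 ^ k) + y = x"
proof -
  define s :: nat where "s = 2 ^ k"
  define d where "d = z' + z"
  have d: "d \<noteq> 0"
    using neq by (simp add: d_def add_eq_0_iff_eq)
  have z': "z' = z + d"
    by (simp add: d_def char2_simps add_ac)
  have a: "a = z * (z ^ s + c)"
    using root by (metis s_def add_eq_0_iff_eq distrib_left mult.commute power_add power_one_right)
  have zds: "(z + d) ^ s = z ^ s + d ^ s"
    by (simp add: s_def add_power_two_power)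
  have "(z ^ s + d ^ s) * (z + d) + c * (z + d) + z * (z ^ s + c) = 0"
    using root' unfolding z' a by (simp add: zds mult.commute flip: s_def)
  then have "d * (z ^ s + c) + z * d ^ s + d * d ^ s = 0"
    by (simp add: algebra_simps char2_simps)
  then have eq: "d * (z ^ s + c) + z * d ^ s = d * d ^ s"
    by (simp add: add_eq_0_iff_eq)
  have "z * (d * d ^ s) * (y ^ s + y) = d * ((z * x) ^ s * z) + z * z * x * d ^ s"
    using d by (simp add: y_def flip: d_def) (simp add: field_simps power_divide)
  also have "\<dots> = d * (z * (z ^ s + c) * x) + z * z * x * d ^ s"
    using ax by (simp only: a s_def)
  also have "\<dots> = z * x * (d * (z ^ s + c) + z * d ^ s)"
    by (simp add: algebra_simps)
  also have "\<dots> = z * (d * d ^ s) * x"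
    by (simp add: eq mult_ac)
  finally show ?thesis
    using z d by (simp add: s_def)
qed

lemma inj_on_trace_class:
  fixes \<alpha> :: nat
  assumes e: "tr x = e" "tr x' = e" and nz: "x \<noteq> 0" "x' \<noteq> 0" "a \<noteq> 0"
    and a: "(Q x + of_nat \<alpha> * e) ^ (2 ^ k + 1) = a * x\<^sup>2"
    and a': "(Q x' + of_nat \<alpha> * e) ^ (2 ^ k + 1) = a * x'\<^sup>2"
    and tra: "e = 0 \<Longrightarrow> tr a = 0"
  shows "x = x'"
proof (rule ccontr)
  assume neq: "x \<noteq> x'"
  define b where "b = of_nat \<alpha> * e"
  have b: "b \<in> {0, 1}"
    using tr_bit[of x] e by (auto simp: b_def of_nat_parity)
  define P P' where "P = Q x + b" and "P' = Q x' + b"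
  define z z' where "z = P / x" and "z' = P' / x'"
  define c c' where "c = z ^ (2 ^ k) + a / z" and "c' = z' ^ (2 ^ k) + a / z'"
  have P: "P \<noteq> 0" "P' \<noteq> 0"
    using a a' nz by (auto simp: P_def P'_def b_def)
  note root = root_equations[OF nz(1) P(1)[unfolded P_def] b a[folded b_def],
      folded P_def, folded z_def, folded c_def, unfolded e]
  note root' = root_equations[OF nz(2) P(2)[unfolded P'_def] b a'[folded b_def],
      folded P'_def, folded z'_def, folded c'_def, unfolded e]
  have of_nat_eq_1: "(of_nat m :: 'a) = 1 \<or> (of_nat r :: 'a) = 1"
    using odd_m_or_r by (auto simp: of_nat_parity)
  \<comment> \<open>The right-hand sides of both equations depend only on \<open>a\<close>,
    \<open>b\<close> and \<open>e\<close>, which \<open>x\<close> and \<open>x'\<close>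
    share.\<close>
  then have "c + S a = c' + S a"
  proof
    assume "(of_nat m :: 'a) = 1"
    then show ?thesis
      using root(5) root'(5) by (simp only: mult_1)
  next
    assume "(of_nat r :: 'a) = 1"
    then show ?thesis
      using root(6) root'(6) by (simp only: mult_1)
  qed
  then have c': "c' = c"
    by simp
  have z: "z \<noteq> 0"
    using nz P by (simp add: z_def)
  have zz': "z' \<noteq> z"
    using neq root(2) root'(2) by metis
  \<comment> \<open>The second conjunct recovers \<open>w\<close> from \<open>y\<close>, so distinct
    roots will give distinct solutions.\<close>
  have other: "\<exists>y. y ^ (2 ^ k) + y = x \<and> y * (w + z) = z * x"
    if "w ^ (2 ^ k + 1) + c * w + a = 0" "w \<noteq> z" for w
    using second_root[OF z that(2) root(1) that(1) root(3)] that(2)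
    by (intro exI[of _ "z * x / (w + z)"]) (simp add: add_eq_0_iff_eq)
  obtain y where y: "y ^ (2 ^ k) + y = x" "y * (z' + z) = z * x"
    using other[OF root'(1)[unfolded c'] zz'] by blast
  have "e = tr (y ^ (2 ^ k) + y)"
    using y(1) e by simp
  then have e0: "e = 0"
    by (simp only: tr_add tr_power add_self)
  then obtain w where w: "w\<^sup>2 + w = a"
    using tra artin_schreier by blast
  have "c + S a = 1"
    using of_nat_eq_1
  proof
    assume "(of_nat m :: 'a) = 1"
    then show ?thesis
      using root(5) tra[OF e0] e0 by (simp only: mult_1 mult_zero_right add_0_right)
  next
    assume "(of_nat r :: 'a) = 1"
    then show ?thesis
      using root(6) tra[OF e0] e0 by (simp only: b_def mult_1 mult_zero_right add_0_right)
  qed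
  then have c: "c = 1 + S a"
    by (rule add_eq_iff[THEN iffD1])
  \<comment> \<open>Here \<open>S a\<close> collapses to \<open>v ^ (2 ^ k) + v\<close>, which makes
    \<open>v\<close> a root. Also \<open>v + 1 + a / v = 0\<close>, whereas the same expression at
    \<open>z\<close> and \<open>z'\<close> gives the nonzero \<open>x\<close> and
    \<open>x'\<close>.\<close>
  have artin_root: "v ^ (2 ^ k + 1) + c * v + a = 0" "v \<noteq> z" "v \<noteq> z'" if v: "v\<^sup>2 + v = a" for v
  proof -
    have "S a = v ^ (2 ^ k) + v"
      using S_telescope[of v] frob_sum_power[of 1 k v 1] frob_sum_add[of 1 k "v\<^sup>2" v] v by simp
    then show "v ^ (2 ^ k + 1) + c * v + a = 0"
      by (simp add: c v[symmetric] power2_eq_square algebra_simps char2_simps)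
    have "v \<noteq> 0"
      using v nz(3) by auto
    then have "a / v = v + 1"
      by (simp add: v[symmetric] power2_eq_square add_divide_distrib)
    then have "v + 1 + a / v = 0"
      by (simp only: add_self)
    then show "v \<noteq> z" "v \<noteq> z'"
      using root(2) root'(2) nz by metis+
  qed
  have w1: "(w + 1)\<^sup>2 + (w + 1) = a"
    using w by (simp add: add_square char2_simps add_ac)
  obtain y1 where y1: "y1 ^ (2 ^ k) + y1 = x" "y1 * (w + z) = z * x"
    using other[OF artin_root(1,2)[OF w]] by blast
  obtain y2 where y2: "y2 ^ (2 ^ k) + y2 = x" "y2 * (w + 1 + z) = z * x"
    using other[OF artin_root(1,2)[OF w1]] by blast
  \<comment> \<open>The difference of two solutions is fixed by the Frobenius power, hence a
    bit.\<close>
  have two_solutions: "v \<in> {y, y + 1}" if "v ^ (2 ^ k) + v = x" for v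
  proof -
    have "(v + y) ^ (2 ^ k) + (v + y) = (v ^ (2 ^ k) + v) + (y ^ (2 ^ k) + y)"
      by (simp only: add_power_two_power add_ac)
    then have "v + y \<in> {0, 1}"
      by (intro frobenius_fixed) (simp only: that y add_self add_eq_0_iff_eq)
    then show ?thesis
      by (simp add: add_eq_0_iff_eq add_eq_iff add.commute)
  qed
  have distinct: "u = v" if "t * (u + z) = z * x" "t * (v + z) = z * x" for t u v
  proof -
    have "t \<noteq> 0"
      using that(1) z nz(1) by auto
    moreover have "t * (u + z) = t * (v + z)"
      using that by (simp only:)
    ultimately show ?thesis
      by simp
  qed
  \<comment> \<open>The roots \<open>z'\<close>, \<open>w\<close> and \<open>w + 1\<close> would
    give three distinct solutions \<open>y\<close>, \<open>y1\<close>, \<open>y2\<close>, but only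
    two exist.\<close>
  have "y1 \<noteq> y"
    using distinct[of y w z'] y(2) y1(2) artin_root(3)[OF w] by blast
  moreover have "y2 \<noteq> y"
    using distinct[of y "w + 1" z'] y(2) y2(2) artin_root(3)[OF w1] by blast
  moreover have "y1 \<noteq> y2"
    using distinct[of y1 w "w + 1"] y1(2) y2(2) by auto
  ultimately show False
    using two_solutions[OF y1(1)] two_solutions[OF y2(1)] by auto
qed

section \<open>The mapping on the trace classes\<close>

definition H_fun :: "nat \<Rightarrow> nat \<Rightarrow> 'a \<Rightarrow> 'a" where
  "H_fun \<alpha> \<gamma> x = eval_bit_poly (H_poly m (2 ^ k) r \<alpha> \<gamma>) x"

lemma H_fun_0: "H_fun \<alpha> \<gamma> 0 = 0"
proof -
  have "coeff (H_poly m (2 ^ k) r \<alpha> \<gamma>) 0 = 0"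
    using k_pos by (intro coeff_0_H_poly one_less_power) simp_all
  then show ?thesis
    by (simp add: H_fun_def eval_bit_poly_def poly_0_coeff_0 coeff_map_poly)
qed

text \<open>Clears the exact division by the square of the variable; in characteristic 2, adding the
  \<open>\<gamma>\<close> term again removes it.\<close>

lemma H_fun_eq:
  "(H_fun \<alpha> \<gamma> x + of_nat \<gamma> * tr x) * x\<^sup>2 = (Q x + of_nat \<alpha> * tr x) ^ (2 ^ k + 1)"
proof -
  let ?N = "H_numerator m (2 ^ k) r \<alpha>"
  have bit: "of_bit (of_nat n) = (of_nat n :: 'a)" for n
    by (simp only: even_of_nat of_nat_parity)
  have "?N div monom 1 2 * monom 1 2 = ?N"
    by (intro dvd_div_mult_self X_squared_dvd_H_numerator) simp
  then have "eval_bit_poly (?N div monom 1 2) x * x\<^sup>2 = eval_bit_poly ?N x"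
    by (metis eval_bit_poly_mult eval_bit_poly_monom)
  moreover have "eval_bit_poly ?N x = (Q x + of_nat \<alpha> * tr x) ^ (2 ^ k + 1)"
    by (simp only: H_numerator_def eval_bit_poly_power eval_bit_poly_add eval_bit_poly_smult
      eval_bit_poly_sum eval_bit_poly_monom eval_trace_poly bit frob_sum_def[of "2 ^ k"] add.commute)
  moreover have "H_fun \<alpha> \<gamma> x + of_nat \<gamma> * tr x = eval_bit_poly (?N div monom 1 2) x"
    unfolding H_fun_def H_poly_def eval_bit_poly_add eval_bit_poly_smult eval_trace_poly bit
    by (simp add: char2_simps add_ac)
  ultimately show ?thesis
    by simp
qed

text \<open>For \<open>x \<noteq> 0\<close>, the quotient is
  \<open>(P / x)\<^sup>2 + P / x + P\<close>, whose first two terms have equal trace; what remains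
  is the trace of \<open>P\<close>.\<close>

lemma tr_H_fun: "tr (H_fun \<alpha> \<gamma> x) = of_nat (r + (\<alpha> + \<gamma>) * m) * tr x"
proof (cases "x = 0")
  case True
  have "tr 0 = 0"
    using frob_sum_0[of 1 m] by simp
  with True show ?thesis
    by (simp add: H_fun_0)
next
  case False
  define b where "b = of_nat \<alpha> * tr x"
  define P where "P = Q x + b"
  define a where "a = H_fun \<alpha> \<gamma> x + of_nat \<gamma> * tr x"
  have b: "b \<in> {0, 1}" and g: "of_nat \<gamma> * tr x \<in> {0, 1}"
    using tr_bit[of x] by (auto simp: b_def of_nat_parity)
  have tele: "P ^ (2 ^ k) = P + x\<^sup>2 + x"
    unfolding P_def by (rule Q_bit_power[OF b])
  have "a * x\<^sup>2 = P * P ^ (2 ^ k)"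
    using H_fun_eq[of \<alpha> \<gamma> x] by (simp add: a_def P_def b_def)
  also have "\<dots> = ((P / x)\<^sup>2 + P / x + P) * x\<^sup>2"
    unfolding tele using False by (simp add: field_simps power2_eq_square)
  finally have "a = (P / x)\<^sup>2 + P / x + P"
    using False by simp
  then have "tr a = tr P"
    by (simp only: tr_add tr_square_arg add_self add_0)
  also have "\<dots> = of_nat r * tr x + of_nat m * b"
    by (simp only: P_def tr_add tr_frob_sum tr_bit_mult[OF b])
  finally have "tr (H_fun \<alpha> \<gamma> x) + of_nat m * (of_nat \<gamma> * tr x) = of_nat r * tr x + of_nat m * b"
    by (simp only: a_def tr_add tr_bit_mult[OF g])
  then show ?thesis
    unfolding add_eq_iff by (simp add: b_def algebra_simps)
qed

lemma inj_on_H_fun: "inj_on (H_fun \<alpha> \<gamma>) {x. tr x = e}"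
proof (rule inj_onI)
  fix x x' assume "x \<in> {x. tr x = e}" "x' \<in> {x. tr x = e}" and eq: "H_fun \<alpha> \<gamma> x = H_fun \<alpha> \<gamma> x'"
  then have e: "tr x = e" "tr x' = e"
    by auto
  define b where "b = of_nat \<alpha> * e"
  define a where "a = H_fun \<alpha> \<gamma> x + of_nat \<gamma> * e"
  have b: "b \<in> {0, 1}"
    using tr_bit[of x] e by (auto simp: b_def of_nat_parity)
  have ax: "(Q x + b) ^ (2 ^ k + 1) = a * x\<^sup>2" and ax': "(Q x' + b) ^ (2 ^ k + 1) = a * x'\<^sup>2"
    using H_fun_eq[of \<alpha> \<gamma> x] H_fun_eq[of \<alpha> \<gamma> x'] eq e by (simp_all add: a_def b_def)
  have tra: "tr a = 0" if "e = 0"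
    using tr_H_fun[of \<alpha> \<gamma> x] e that by (simp add: a_def)
  show "x = x'"
  proof (cases "a = 0")
    case False
    \<comment> \<open>At \<open>v = 0\<close> both \<open>e\<close> and
      \<open>H_fun \<alpha> \<gamma> v\<close> vanish, contradicting
      \<open>a \<noteq> 0\<close>.\<close>
    have "v \<noteq> 0" if "tr v = e" "H_fun \<alpha> \<gamma> v + of_nat \<gamma> * e \<noteq> 0" for v
      using that frob_sum_0[of 1 m] by (auto simp: H_fun_0)
    then have "x \<noteq> 0" "x' \<noteq> 0"
      using e False eq by (auto simp: a_def)
    then show ?thesis
      using inj_on_trace_class e False ax ax' tra unfolding b_def by blast
  next
    case True
    \<comment> \<open>Now \<open>Q v\<close> is the bit \<open>b\<close>, so telescoping forces
      \<open>v\<close> to be a bit. The case \<open>v = 1\<close>, \<open>e = 0\<close> would make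
      both \<open>m\<close> and \<open>r\<close> even.\<close>
    have "v = e" if "tr v = e" "(Q v + b) ^ (2 ^ k + 1) = a * v\<^sup>2" for v
    proof -
      have Qb: "Q v = b"
        using that(2) True by (simp add: add_eq_0_iff_eq)
      have "b ^ (2 ^ k) = b"
        using b by auto
      then have "v\<^sup>2 + v = 0"
        using Q_telescope[of v] by (simp only: Qb add_self)
      then have v: "v \<in> {0, 1}"
        by (simp only: add_eq_0_iff_eq square_eq_self_iff)
      show ?thesis
      proof (cases "v = 0")
        case True
        then show ?thesis
          using that(1) frob_sum_0[of 1 m] by simp
      next
        case False
        then have v1: "v = 1"
          using v by simp
        show ?thesis
          using odd_m_or_r that(1) Qb by (auto simp: v1 frob_sum_1 b_def of_nat_parity split: if_splits)
      qed
    qed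
    then show ?thesis
      using e ax ax' by metis
  qed
qed

lemma card_trace_set: "card (trace_set m e :: 'a set) = card {x. tr x = 0}"
  by (cases e) (simp_all add: trace_set_eq card_tr_sets)

lemma trace_sets_cover: "trace_set m 0 \<union> trace_set m 1 = (UNIV :: 'a set)"
  using tr_bit by (auto simp: trace_set_eq)

text \<open>All trace classes have equal size, so injectivity into the target class
  suffices.\<close>

lemma bij_betw_H_fun:
  "bij_betw (H_fun \<alpha> \<gamma>) (trace_set m e) (trace_set m (of_nat (r + (\<alpha> + \<gamma>) * m) * e))"
proof -
  have inj: "inj_on (H_fun \<alpha> \<gamma>) (trace_set m e)"
    unfolding trace_set_eq by (rule inj_on_H_fun)
  have "of_bit (of_nat n * e) = (of_nat n * of_bit e :: 'a)" for n
    by (cases e) (simp_all only: even_of_nat of_nat_parity mult_zero_right mult_1_right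
        even_zero odd_one of_bool_eq not_True_eq_False not_False_eq_True)
  then have "H_fun \<alpha> \<gamma> ` trace_set m e \<subseteq> trace_set m (of_nat (r + (\<alpha> + \<gamma>) * m) * e)"
    unfolding trace_set_eq by (intro image_subsetI) (simp only: mem_Collect_eq tr_H_fun)
  then have "H_fun \<alpha> \<gamma> ` trace_set m e = trace_set m (of_nat (r + (\<alpha> + \<gamma>) * m) * e)"
    by (intro card_seteq) (simp_all add: card_image[OF inj] card_trace_set)
  with inj show ?thesis
    by (simp add: bij_betw_def)
qed

text \<open>For odd \<open>n\<close> the two bijections cover complementary classes; for even
  \<open>n\<close> both have the trace 0 class as image, although the trace 1 class is
  nonempty.\<close>

lemma bij_H_fun_iff: "bij (H_fun \<alpha> \<gamma>) \<longleftrightarrow> odd (r + (\<alpha> + \<gamma>) * m)"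
proof -
  define n where "n = r + (\<alpha> + \<gamma>) * m"
  have b0: "bij_betw (H_fun \<alpha> \<gamma>) (trace_set m 0) (trace_set m 0)"
    using bij_betw_H_fun[of \<alpha> \<gamma> 0] by simp
  have b1: "bij_betw (H_fun \<alpha> \<gamma>) (trace_set m 1) (trace_set m (of_nat n))"
    using bij_betw_H_fun[of \<alpha> \<gamma> 1] by (simp add: n_def)
  have disj: "trace_set m 0 \<inter> trace_set m 1 = ({} :: 'a set)"
    by (auto simp: trace_set_eq)
  have "bij (H_fun \<alpha> \<gamma>)" if "odd n"
  proof -
    have "(of_nat n :: bit) = 1"
      using that by (metis bit_not_zero_iff even_of_nat even_zero)
    then have "bij_betw (H_fun \<alpha> \<gamma>) (trace_set m 0 \<union> trace_set m 1) (trace_set m 0 \<union> trace_set m 1)"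
      using b0 b1 disj by (intro bij_betw_combine) simp_all
    then show ?thesis
      by (simp add: trace_sets_cover)
  qed
  moreover have "odd n" if "bij (H_fun \<alpha> \<gamma>)"
  proof (rule ccontr)
    assume "\<not> odd n"
    then have "(of_nat n :: bit) = 0"
      by (metis bit_not_one_iff even_of_nat odd_one)
    then have "H_fun \<alpha> \<gamma> ` trace_set m 0 = H_fun \<alpha> \<gamma> ` trace_set m 1"
      using b0 b1 by (simp add: bij_betw_def)
    then have "trace_set m 0 = (trace_set m 1 :: 'a set)"
      using that by (simp add: bij_def inj_image_eq_iff)
    then have "trace_set m 1 = ({} :: 'a set)"
      using disj by simp
    then show False
      using ex_tr_1 by (auto simp: trace_set_eq)
  qed
  ultimately show ?thesis
    by (auto simp: n_def)
qed

end

theorem theorem1p2: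
  fixes m k r \<alpha> \<gamma> :: nat
    and H :: "'a::{field, finite} poly"
  assumes "m > 0" and "k > 0" and "gcd k m = 1"
    and "r \<in> {1..m - 1}" and "[k * r = 1] (mod m)"
    and "\<alpha> \<in> {0, 1}" and "\<gamma> \<in> {0, 1}"
    and "CARD('a) = 2 ^ m"
  defines "H \<equiv> base_change (H_poly m (2 ^ k) r \<alpha> \<gamma>)"
  shows "bij_betw (poly H) (trace_set m 0) (trace_set m 0) \<and>
    bij_betw (poly H) (trace_set m 1) (trace_set m (of_nat (r + (\<alpha> + \<gamma>) * m))) \<and>
    (permutation_polynomial H \<longleftrightarrow> [r + (\<alpha> + \<gamma>) * m = 1] (mod 2))"
proof -
  \<comment> \<open>Makes the natural-number subtraction \<open>k * r - 1\<close> exact, so the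
    congruence yields \<open>j\<close>.\<close>
  have "k * r \<ge> 1"
    using assms(2,4) by simp
  then have "m dvd k * r - 1"
    using assms(5) cong_altdef_nat by blast
  then obtain j where j: "k * r - 1 = m * j"
    by (elim dvdE)
  interpret frobenius_pair m "TYPE('a)" k r j
  proof
    show "k * r = m * j + 1"
      using j \<open>k * r \<ge> 1\<close> by linarith
  qed (rule assms(8))
  have H: "poly H = H_fun \<alpha> \<gamma>"
    by (rule ext) (simp only: H_def H_fun_def eval_bit_poly_def)
  have "odd n \<longleftrightarrow> [n = 1] (mod 2)" for n :: nat
    by (simp add: cong_def odd_iff_mod_2_eq_one)
  then show ?thesis
    using bij_betw_H_fun[of \<alpha> \<gamma> 0] bij_betw_H_fun[of \<alpha> \<gamma> 1] bij_H_fun_iff[of \<alpha> \<gamma>]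
    unfolding H permutation_polynomial_def by (simp only: mult_zero_right mult_1_right)
qed

end
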